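(* Let $r\ge 1$ be an integer, $\lambda_r\in\mathbb{C}\setminus\{0,1\}$, and write $r=2r'$ or $r=2r'+1$ with $r'\ge0$ an integer. Let $\lambda^{dX}_{n,m}$ be the coefficients in $P^{d}_n(\lambda_r;r)(x)=\sum_{m=0}^{n}\lambda^{dX}_{n,m}x^m$. Then: \begin{enumerate} \item For $0\le k\le r$: $\lambda^{dX}_{k,\nu}=C_{k,\nu}$, $0\le\nu\le k$. \item For $r'+1\le k'\le r-1$ (for $r=2r'$ or $r=2r'+1$): $$\lambda^{dX}_{2k',2\nu+1}=0,\quad 0\le\nu\le k'-1,$$ $$\lambda^{dX}_{2k',2\nu}=C_{2k',2\nu}+\frac{1-\lambda_r}{4^{k'}}\sum_{j=r-k'}^{k'-1}4^{j}C_{2j,2\nu},\quad 0\le\nu\le r-k',$$ $$\lambda^{dX}_{2k',2\nu}=C_{2k',2\nu}+\frac{1-\lambda_r}{4^{k'}}\sum_{j=\nu}^{k'-1}4^{j}C_{2j,2\nu},\quad r-k'+1\le\nu\le k'-1.$$ \item For $r'\le k'\le r-1$ if $r=2r'$, or for $r'+1\le k'\le r-1$ if $r=2r'+1$: $$\lambda^{dX}_{2k'+1,2\nu}=0,\quad 0\le\nu\le k',$$ $$\lambda^{dX}_{2k'+1,2\nu+1}=C_{2k'+1,2\nu+1}+\frac{1-\lambda_r}{4^{k'}}\sum_{j=r-k'-1}^{k'-1}4^{j}C_{2j+1,2\nu+1},\quad 0\le\nu\le r-k'-1,$$ $$\lambda^{dX}_{2k'+1,2\nu+1}=C_{2k'+1,2\nu+1}+\frac{1-\lambda_r}{4^{k'}}\sum_{j=\nu}^{k'-1}4^{j}C_{2j+1,2\nu+1},\quad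 r-k'\le\nu\le k'-1.$$ \item For $n\ge 0$: $$\lambda^{dX}_{2(n+r),2\nu+1}=0,\quad 0\le\nu\le n+r-1,$$ $$\lambda^{dX}_{2(n+r),2\nu}=C_{2(n+r),2\nu}+\frac{1-\lambda_r}{4^{n+r}}\sum_{j=n}^{n+r-1}4^{j}C_{2j,2\nu},\quad 0\le\nu\le n,$$ $$\lambda^{dX}_{2(n+r),2\nu}=C_{2(n+r),2\nu}+\frac{1-\lambda_r}{4^{n+r}}\sum_{j=\nu}^{n+r-1}4^{j}C_{2j,2\nu},\quad n+1\le\nu\le n+r-1,$$ $$\lambda^{dX}_{2(n+r)+1,2\nu}=0,\quad 0\le\nu\le n+r,$$ $$\lambda^{dX}_{2(n+r)+1,2\nu+1}=C_{2(n+r)+1,2\nu+1}+\frac{1-\lambda_r}{4^{n+r}}\sum_{j=n}^{n+r-1}4^{j}C_{2j+1,2\nu+1},\quad 0\le\nu\le n,$$ $$\lambda^{dX}_{2(n+r)+1,2\nu+1}=C_{2(n+r)+1,2\nu+1}+\frac{1-\lambda_r}{4^{n+r}}\sum_{j=\nu}^{n+r-1}4^{j}C_{2j+1,2\nu+1},\quad n+1\le\nu\le n+r-1.$$ \end{enumerate}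
   Context: $\{P_n\}_{n\ge0}$ denotes the monic Chebyshev polynomials of the second kind: $P_0=1$, $P_1=x$, $P_{n+2}(x)=xP_{n+1}(x)-\frac14P_n(x)$ for $n\ge 0$, and $C_{n,m}$ denotes the coefficient of $x^m$ in $P_n$, i.e. $P_n(x)=\sum_{m=0}^nC_{n,m}x^m$. For an integer $r\ge 1$ and $\lambda_r\in\mathbb{C}\setminus\{0,1\}$, the $r$th-perturbed sequence by dilatation $\{P^d_n(\lambda_r;r)\}_{n\ge 0}$ is the monic sequence with $P^d_0=1$, $P^d_1(x)=x$, $P^d_{n+2}(x)=xP^d_{n+1}(x)-\gamma_{n+1}P^d_n(x)$ for $n\ge 0$, where $\gamma_r=\lambda_r/4$ and $\gamma_{n+1}=1/4$ for $n\ge 0$, $n\ne r-1$. Index ranges whose upper bound is smaller than the lower bound are empty. *)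

theory Defs
  imports Complex_Main "HOL-Computational_Algebra.Polynomial"
begin

text \<open>Monic Chebyshev polynomials of the second kind (that is, \<open>2\<^sup>-\<^sup>n U\<^sub>n\<close>).\<close>

fun chebyP :: "nat \<Rightarrow> complex poly" where
  "chebyP 0 = 1"
| "chebyP (Suc 0) = [:0, 1:]"
| "chebyP (Suc (Suc n)) = [:0, 1:] * chebyP (Suc n) - smult (1/4) (chebyP n)"

definition chebyC :: "nat \<Rightarrow> nat \<Rightarrow> complex" where
  "chebyC n m = coeff (chebyP n) m"

text \<open>Only the values at indices \<open>n \<ge> 1\<close> enter the recurrence below.\<close>

definition dil_gamma :: "complex \<Rightarrow> nat \<Rightarrow> nat \<Rightarrow> complex" where
  "dil_gamma lam r n = (if n = r then lam / 4 else 1 / 4)"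

fun chebyPd :: "complex \<Rightarrow> nat \<Rightarrow> nat \<Rightarrow> complex poly" where
  "chebyPd lam r 0 = 1"
| "chebyPd lam r (Suc 0) = [:0, 1:]"
| "chebyPd lam r (Suc (Suc n)) =
     [:0, 1:] * chebyPd lam r (Suc n) - smult (dil_gamma lam r (n + 1)) (chebyPd lam r n)"

definition lambda_dX :: "complex \<Rightarrow> nat \<Rightarrow> nat \<Rightarrow> nat \<Rightarrow> complex" where
  "lambda_dX lam r n m = coeff (chebyPd lam r n) m"

end

theory Submission
  imports Defs
begin

text \<open>
  The perturbation enters the recurrence only once, so for \<open>m \<ge> 0\<close> the difference
  \<open>P\<^sup>d\<^bsub>r+1+m\<^esub> - P\<^bsub>r+1+m\<^esub>\<close> is \<open>(1 - \<lambda>)/4\<close> times \<open>P\<^bsub>r-1\<^esub> P\<^bsub>m\<^esub>\<close>. The addition formula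
  \<open>P\<^bsub>a+b+2\<^esub> = P\<^bsub>a+1\<^esub> P\<^bsub>b+1\<^esub> - P\<^bsub>a\<^esub> P\<^bsub>b\<^esub> / 4\<close> linearizes this product into a sum of polynomials whose indices
  increase in steps of two. The coefficient formulas follow by comparing coefficients and dropping
  the terms whose degree is too small.
\<close>

text \<open>The right-hand side does not change when one index moves from \<open>b\<close> to
  \<open>a\<close>: expanding P_(b+2) or P_(a+2) by the recurrence gives the same polynomial. Hence
  \<open>a\<close> stays arbitrary in the induction on \<open>b\<close>.\<close>

lemma chebyP_add:
  "chebyP (Suc (Suc (a + b))) = chebyP (Suc a) * chebyP (Suc b) - smult (1/4) (chebyP a * chebyP b)"
proof (induction b arbitrary: a)
  case 0
  then show ?case by (simp add: mult.commute)
next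
  case (Suc b)
  show ?case
    using Suc.IH[of "Suc a"] by (simp add: algebra_simps smult_diff_right)
qed

text \<open>The sum telescopes: the weights \<open>4 ^ j\<close> absorb the 1/4 of the addition
  formula, so each term after the first is a difference of consecutive right-hand sides. The offset
  \<open>e\<close> serves both parities at once.\<close>

lemma sum_chebyP_eq_product:
  "(\<Sum>j = s..s + b. smult (4 ^ j) (chebyP (2 * j + e)))
     = smult (4 ^ (s + b)) (chebyP (2 * s + e + b) * chebyP b)"
proof (induction b)
  case 0
  then show ?case by simp
next
  case (Suc b)
  have "2 * Suc (s + b) + e = Suc (Suc (2 * s + e + b + b))"
    by simp
  then have "chebyP (2 * Suc (s + b) + e) = chebyP (Suc (2 * s + e + b)) * chebyP (Suc b)
      - smult (1/4) (chebyP (2 * s + e + b) * chebyP b)"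
    using chebyP_add[of "2 * s + e + b" b] by metis
  then have "smult (4 ^ Suc (s + b)) (chebyP (2 * Suc (s + b) + e))
      = smult (4 ^ Suc (s + b)) (chebyP (Suc (2 * s + e + b)) * chebyP (Suc b))
        - smult (4 ^ (s + b)) (chebyP (2 * s + e + b) * chebyP b)"
    by (simp only: smult_diff_right smult_smult) simp
  then show ?case
    using Suc.IH by (simp only: add_Suc_right sum.cl_ivl_Suc) simp
qed

lemma chebyC_eq_0: "n < m \<Longrightarrow> chebyC n m = 0"
  unfolding chebyC_def
proof (induction n arbitrary: m rule: chebyP.induct)
  case (3 n)
  then show ?case by (cases m) auto
qed (auto simp: coeff_pCons split: nat.splits)

lemma lambda_dX_parity: "odd (n + m) \<Longrightarrow> lambda_dX lam r n m = 0"
  unfolding lambda_dX_def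
proof (induction lam r n arbitrary: m rule: chebyPd.induct)
  case (3 lam r n)
  then show ?case by (cases m) auto
qed (auto simp: coeff_pCons odd_pos split: nat.splits)

lemma chebyPd_eq_chebyP: "n \<le> r \<Longrightarrow> chebyPd lam r n = chebyP n"
  by (induction n rule: chebyP.induct) (auto simp: dil_gamma_def)

text \<open>Beyond the perturbed step both sequences obey the same recurrence, hence so does their
  difference in \<open>m\<close>. Only \<open>m = 0\<close>, where \<open>lam\<close> enters, and
  \<open>m = 1\<close> need separate treatment.\<close>

lemma chebyPd_eq_chebyP_plus_product:
  "chebyPd lam (Suc s) (Suc (Suc (s + m)))
     = chebyP (Suc (Suc (s + m))) + smult ((1 - lam) / 4) (chebyP s * chebyP m)"
proof (induction m rule: chebyP.induct)
  case 1
  have "smult (lam / 4) (chebyP s) = smult (1/4) (chebyP s) - smult ((1 - lam) / 4) (chebyP s)"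
    by (simp add: smult_diff_left [symmetric] diff_divide_distrib)
  then show ?case by (simp add: chebyPd_eq_chebyP dil_gamma_def)
next
  case 2
  then show ?case
    by (auto simp: chebyPd_eq_chebyP dil_gamma_def algebra_simps smult_diff_left smult_diff_right
        smult_add_right diff_divide_distrib)
next
  case (3 m)
  have "chebyPd lam (Suc s) (Suc (Suc (s + Suc (Suc m))))
      = [:0, 1:] * chebyPd lam (Suc s) (Suc (Suc (s + Suc m)))
        - smult (1/4) (chebyPd lam (Suc s) (Suc (Suc (s + m))))"
    by (simp add: dil_gamma_def)
  then show ?case
    unfolding "3.IH"
    by (simp add: algebra_simps smult_diff_right smult_add_right)
qed

text \<open>The product of P_b and P_(2s+e+b) is symmetric, so either factor may play the role of
  P_(r-1). With k = s+b+1 the alternatives read k = r+s and r = k+s+e.\<close>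

lemma lambda_dX_sum:
  assumes "r = Suc b \<or> r = Suc (2 * s + e + b)"
  shows "lambda_dX lam r (2 * Suc (s + b) + e) m = chebyC (2 * Suc (s + b) + e) m
     + (1 - lam) / 4 ^ Suc (s + b) * (\<Sum>j = s..s + b. 4 ^ j * chebyC (2 * j + e) m)"
proof -
  have idx: "2 * Suc (s + b) + e = Suc (Suc (b + (2 * s + e + b)))"
    "2 * Suc (s + b) + e = Suc (Suc (2 * s + e + b + b))"
    by simp_all
  have "chebyPd lam r (2 * Suc (s + b) + e) = chebyP (2 * Suc (s + b) + e)
     + smult ((1 - lam) / 4) (chebyP (2 * s + e + b) * chebyP b)"
    using assms
  proof
    assume "r = Suc b"
    then show ?thesis
      unfolding idx(1) using chebyPd_eq_chebyP_plus_product by (metis mult.commute)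
  next
    assume "r = Suc (2 * s + e + b)"
    then show ?thesis
      unfolding idx(2) using chebyPd_eq_chebyP_plus_product by metis
  qed
  also have "smult ((1 - lam) / 4) (chebyP (2 * s + e + b) * chebyP b)
     = smult ((1 - lam) / 4 ^ Suc (s + b)) (\<Sum>j = s..s + b. smult (4 ^ j) (chebyP (2 * j + e)))"
    unfolding sum_chebyP_eq_product by simp
  finally show ?thesis
    by (simp add: lambda_dX_def chebyC_def coeff_sum)
qed

text \<open>The summation may start at \<open>s\<close> or, as the omitted terms vanish, anywhere between \<open>s\<close> and \<open>\<nu>\<close>.\<close>

lemma lambda_dX_coeff:
  assumes "1 \<le> r" "r < 2 * k + e" "k = r + s \<or> r = k + s + e"
    and "t = s \<or> s \<le> t \<and> t \<le> \<nu>"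
  shows "lambda_dX lam r (2 * k + e) (2 * \<nu> + e) = chebyC (2 * k + e) (2 * \<nu> + e)
     + (1 - lam) / 4 ^ k * (\<Sum>j = t..k - 1. 4 ^ j * chebyC (2 * j + e) (2 * \<nu> + e))"
proof -
  \<comment> \<open>The bounds on \<open>r\<close> force s < k in both alternatives, so the
    truncated subtraction is exact.\<close>
  define b where "b = k - 1 - s"
  have k: "k = Suc (s + b)" and r: "r = Suc b \<or> r = Suc (2 * s + e + b)"
    using assms(1-3) unfolding b_def by auto
  have "(\<Sum>j = s..k - 1. 4 ^ j * chebyC (2 * j + e) (2 * \<nu> + e))
      = (\<Sum>j = t..k - 1. 4 ^ j * chebyC (2 * j + e) (2 * \<nu> + e))"
    using assms(4) by (intro sum.mono_neutral_right) (auto simp: chebyC_eq_0)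
  then show ?thesis
    using lambda_dX_sum[OF r, of lam "2 * \<nu> + e"] by (simp add: k)
qed

lemmas lambda_dX_coeff_even = lambda_dX_coeff[where e = 0, unfolded add_0_right]
lemmas lambda_dX_coeff_odd = lambda_dX_coeff[where e = 1]

theorem theorem4p5:
  fixes r r' :: nat and lam :: complex
  assumes "r \<ge> 1"
    and "lam \<noteq> 0" and "lam \<noteq> 1"
    and "r = 2 * r' \<or> r = 2 * r' + 1"
  shows
    "(\<forall>k \<nu>. k \<le> r \<and> \<nu> \<le> k \<longrightarrow> lambda_dX lam r k \<nu> = chebyC k \<nu>)
   \<and>
    (\<forall>k'. r' + 1 \<le> k' \<and> k' \<le> r - 1 \<longrightarrow>
       (\<forall>\<nu>. \<nu> \<le> k' - 1 \<longrightarrow> lambda_dX lam r (2 * k') (2 * \<nu> + 1) = 0)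
     \<and> (\<forall>\<nu>. \<nu> \<le> r - k' \<longrightarrow>
          lambda_dX lam r (2 * k') (2 * \<nu>) = chebyC (2 * k') (2 * \<nu>)
            + (1 - lam) / 4 ^ k' * (\<Sum>j = r - k'..k' - 1. 4 ^ j * chebyC (2 * j) (2 * \<nu>)))
     \<and> (\<forall>\<nu>. r - k' + 1 \<le> \<nu> \<and> \<nu> \<le> k' - 1 \<longrightarrow>
          lambda_dX lam r (2 * k') (2 * \<nu>) = chebyC (2 * k') (2 * \<nu>)
            + (1 - lam) / 4 ^ k' * (\<Sum>j = \<nu>..k' - 1. 4 ^ j * chebyC (2 * j) (2 * \<nu>))))
   \<and>
    (\<forall>k'. (r = 2 * r' \<and> r' \<le> k' \<or> r = 2 * r' + 1 \<and> r' + 1 \<le> k') \<and> k' \<le> r - 1 \<longrightarrow>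
       (\<forall>\<nu>. \<nu> \<le> k' \<longrightarrow> lambda_dX lam r (2 * k' + 1) (2 * \<nu>) = 0)
     \<and> (\<forall>\<nu>. \<nu> \<le> r - k' - 1 \<longrightarrow>
          lambda_dX lam r (2 * k' + 1) (2 * \<nu> + 1) = chebyC (2 * k' + 1) (2 * \<nu> + 1)
            + (1 - lam) / 4 ^ k' * (\<Sum>j = r - k' - 1..k' - 1. 4 ^ j * chebyC (2 * j + 1) (2 * \<nu> + 1)))
     \<and> (\<forall>\<nu>. r - k' \<le> \<nu> \<and> \<nu> \<le> k' - 1 \<longrightarrow>
          lambda_dX lam r (2 * k' + 1) (2 * \<nu> + 1) = chebyC (2 * k' + 1) (2 * \<nu> + 1)
            + (1 - lam) / 4 ^ k' * (\<Sum>j = \<nu>..k' - 1. 4 ^ j * chebyC (2 * j + 1) (2 * \<nu> + 1))))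
   \<and>
    (\<forall>n.
       (\<forall>\<nu>. \<nu> \<le> n + r - 1 \<longrightarrow> lambda_dX lam r (2 * (n + r)) (2 * \<nu> + 1) = 0)
     \<and> (\<forall>\<nu>. \<nu> \<le> n \<longrightarrow>
          lambda_dX lam r (2 * (n + r)) (2 * \<nu>) = chebyC (2 * (n + r)) (2 * \<nu>)
            + (1 - lam) / 4 ^ (n + r) * (\<Sum>j = n..n + r - 1. 4 ^ j * chebyC (2 * j) (2 * \<nu>)))
     \<and> (\<forall>\<nu>. n + 1 \<le> \<nu> \<and> \<nu> \<le> n + r - 1 \<longrightarrow>
          lambda_dX lam r (2 * (n + r)) (2 * \<nu>) = chebyC (2 * (n + r)) (2 * \<nu>)
            + (1 - lam) / 4 ^ (n + r) * (\<Sum>j = \<nu>..n + r - 1. 4 ^ j * chebyC (2 * j) (2 * \<nu>)))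
     \<and> (\<forall>\<nu>. \<nu> \<le> n + r \<longrightarrow> lambda_dX lam r (2 * (n + r) + 1) (2 * \<nu>) = 0)
     \<and> (\<forall>\<nu>. \<nu> \<le> n \<longrightarrow>
          lambda_dX lam r (2 * (n + r) + 1) (2 * \<nu> + 1) = chebyC (2 * (n + r) + 1) (2 * \<nu> + 1)
            + (1 - lam) / 4 ^ (n + r) * (\<Sum>j = n..n + r - 1. 4 ^ j * chebyC (2 * j + 1) (2 * \<nu> + 1)))
     \<and> (\<forall>\<nu>. n + 1 \<le> \<nu> \<and> \<nu> \<le> n + r - 1 \<longrightarrow>
          lambda_dX lam r (2 * (n + r) + 1) (2 * \<nu> + 1) = chebyC (2 * (n + r) + 1) (2 * \<nu> + 1)
            + (1 - lam) / 4 ^ (n + r) * (\<Sum>j = \<nu>..n + r - 1. 4 ^ j * chebyC (2 * j + 1) (2 * \<nu> + 1))))"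
proof (intro conjI allI impI, goal_cases)
  case (1 k \<nu>)
  then show ?case by (simp add: lambda_dX_def chebyC_def chebyPd_eq_chebyP)
next
  case (2 k' \<nu>)
  then show ?case by (intro lambda_dX_parity) simp
next
  case (3 k' \<nu>)
  \<comment> \<open>Here \<open>s\<close> solves r = k'+s+e with e = 0.\<close>
  with assms show ?case by (intro lambda_dX_coeff_even[where s = "r - k'"]) auto
next
  case (4 k' \<nu>)
  with assms show ?case by (intro lambda_dX_coeff_even[where s = "r - k'"]) auto
next
  case (5 k' \<nu>)
  then show ?case by (intro lambda_dX_parity) simp
next
  case (6 k' \<nu>)
  \<comment> \<open>Now e = 1, which lowers \<open>s\<close> by one; k' \<le> r - 1 keeps the
    subtraction exact.\<close>
  with assms show ?case by (intro lambda_dX_coeff_odd[where s = "r - k' - 1"]) auto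
next
  case (7 k' \<nu>)
  with assms show ?case by (intro lambda_dX_coeff_odd[where s = "r - k' - 1"]) auto
next
  case (8 n \<nu>)
  then show ?case by (intro lambda_dX_parity) simp
next
  case (9 n \<nu>)
  \<comment> \<open>From here on the other alternative k = r+s applies, with k = n+r.\<close>
  with assms show ?case by (intro lambda_dX_coeff_even[where s = n]) auto
next
  case (10 n \<nu>)
  with assms show ?case by (intro lambda_dX_coeff_even[where s = n]) auto
next
  case (11 n \<nu>)
  then show ?case by (intro lambda_dX_parity) simp
next
  case (12 n \<nu>)
  with assms show ?case by (intro lambda_dX_coeff_odd[where s = n]) auto
next
  case (13 n \<nu>)
  with assms show ?case by (intro lambda_dX_coeff_odd[where s = n]) auto
qed

end
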